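(* Let $K$ be a state space, let $K\,\tilde\otimes\, K$ be the joint state space of two copies of $K$, and let two-outcome measurements $\{\mathsf A,\mathsf A'\}$ (on the first copy of $K$), $\{\mathsf B,\mathsf B'\}$ (on the second copy) and a state $\phi\in K\,\tilde\otimes\, K$ be an implementation of the PR-box. Then both pairs $\{\mathsf A,\mathsf A'\}$ and $\{\mathsf B,\mathsf B'\}$ are maximally incompatible. Moreover, let $\iota_{\mathsf A},\Pi_{\mathsf A}$ and $\iota_{\mathsf B},\Pi_{\mathsf B}$ be the maps associated with these maximally incompatible pairs (extended to linear maps $\iota_{\mathsf A},\iota_{\mathsf B}: A(S)^*\to A(K)^*$ and $\Pi_{\mathsf A},\Pi_{\mathsf B}:A(K)^*\to A(S)^*$). Then $$\phi=(\iota_{\mathsf A}\otimes\iota_{\mathsf B})(\phi_S)+\phi^\perp,$$ where $\phi_S=\frac12\big((s_{00}-s_{10})\otimes s_{00}+s_{11}\otimes s_{10}+s_{10}\otimes s_{01}\big)\in S\,\hat\otimes\, S$ and $\phi^\perp\in\ker(\Pi_{\mathsf A})\otimes\ker(\Pi_{\mathsf B})$.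
   Context: **State spaces.** A state space $K$ is a (nonempty) compact convex subset of a finite-dimensional real vector space. $A(K)$ is the space of real affine functions on $K$ with pointwise order, $A(K)^+$ its cone of nonnegative functions, $E(K)=\{f\in A(K):0\le f\le 1\}$ the set of effects, $A(K)^*$ the dual space and $A(K)^{*+}$ the dual cone. $K$ is identified with $\{\psi\in A(K)^{*+}:\psi(1)=1\}$ via evaluation. Affine maps between state spaces are extended (uniquely) to linear maps between the corresponding spaces $A(\cdot)^*$. A two-outcome measurement $\mathsf A$ on $K$, with outcomes $1,-1$, is given by an effect $f_{\mathsf A}\in E(K)$: the outcome $1$ has probability $f_{\mathsf A}(x)$ and $-1$ has probability $1-f_{\mathsf A}(x)$ in the state $x\in K$; every effect is allowed. **Maximal incompatibility.** Measurements given by $f,f'\in E(K)$ are compatible if there is $p\in E(K)$ with $p\le f$, $p\le f'$, $f+f'\le 1+p$. The degree of compatibility of $f,f'$ is the supremum of $\lambda\in[0,1]$ such that for some constants $\mu,\mu'\in[0,1]$ the effects $\lambda f+(1-\lambda)\mu 1$ and $\lambda f'+(1-\lambda)\mu' 1$ are compatible; it is always $\ge 1/2$, and the measurements are maximally incompatible if it equals $1/2$. A witness square for $f,f'$ is a family of points $x_{00},x_{10},x_{01},x_{11}\in K$ with $\frac12(x_{00}+x_{11})=\frac12(x_{10}+x_{01})$ and $f(x_{ij})=i$, $f'(x_{ij})=j$ for $i,j\in\{0,1\}$. It is known that $f,f'$ are maximally incompatible if and only if a witness square exists. **Square state space.** $S$ is the square with extreme points $s_{00},s_{10},s_{01},s_{11}$,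 $\frac12(s_{00}+s_{11})=\frac12(s_{10}+s_{01})$; $\pi_0,\pi_1\in E(S)$ are given by $\pi_0(s_{ij})=i$, $\pi_1(s_{ij})=j$. **Maps associated with a maximally incompatible pair.** Measurements $\mathsf A,\mathsf A'$ on $K$ with effects $f_{\mathsf A},f_{\mathsf A'}$ are maximally incompatible if and only if there are affine maps $\iota_{\mathsf A}:S\to K$ and $\Pi_{\mathsf A}:K\to S$ such that $\Pi_{\mathsf A}\circ\iota_{\mathsf A}=\mathrm{id}$, $f_{\mathsf A}(\iota_{\mathsf A}(s_{ij}))=\pi_0(s_{ij})$ and $f_{\mathsf A'}(\iota_{\mathsf A}(s_{ij}))=\pi_1(s_{ij})$ for $i,j\in\{0,1\}$. The maps associated with the pair are these maps, constructed from a witness square $\{x_{ij}\}$ of the pair by $\iota_{\mathsf A}(s_{ij})=x_{ij}$ and $\Pi_{\mathsf A}(x)=f_{\mathsf A}(x)(s_{10}-s_{00})+f_{\mathsf A'}(x)(s_{01}-s_{00})+s_{00}$. ($\Pi_{\mathsf A}$ is determined by the pair of measurements, while $\iota_{\mathsf A}$ is given by the choice of the witness square, which may be non-unique.) The maps $\iota_{\mathsf B},\Pi_{\mathsf B}$ are those for the pair $\mathsf B,\mathsf B'$. **Joint state spaces.** $K\,\dot\otimes\, K=\mathrm{conv}\{x\otimes y:x,y\in K\}$ and $K\,\hat\otimes\, K=\{\psi\in A(K)^*\otimes A(K)^*:(f\otimes g)(\psi)\ge0\ \forall f,g\in A(K)^+,\ (1\otimes1)(\psi)=1\}$ (and likewise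 $S\,\hat\otimes\, S$). A joint state space $K\,\tilde\otimes\, K$ is a compact convex set, specified by the theory, with $K\,\dot\otimes\, K\subseteq K\,\tilde\otimes\, K\subseteq K\,\hat\otimes\, K$. **PR-box.** For $\mathsf C\in\{\mathsf A,\mathsf A'\}$, $\mathsf D\in\{\mathsf B,\mathsf B'\}$ and $\epsilon,\eta\in\{1,-1\}$ put $P_\phi(\epsilon,\eta|\mathsf C,\mathsf D)=(f_{\mathsf C}^{\epsilon}\otimes f_{\mathsf D}^{\eta})(\phi)$ with $f^{1}=f$, $f^{-1}=1-f$. The data $\{\mathsf A,\mathsf A'\},\{\mathsf B,\mathsf B'\},\phi$ are an implementation of the PR-box if $P_\phi(\epsilon,\eta|\mathsf C,\mathsf D)=\frac12$ when [$(\mathsf C,\mathsf D)\ne(\mathsf A',\mathsf B')$ and $\epsilon\eta=1$] or [$(\mathsf C,\mathsf D)=(\mathsf A',\mathsf B')$ and $\epsilon\eta=-1$], and $P_\phi(\epsilon,\eta|\mathsf C,\mathsf D)=0$ otherwise. (Equivalently, $E(\mathsf A,\mathsf B)+E(\mathsf A,\mathsf B')+E(\mathsf A',\mathsf B)-E(\mathsf A',\mathsf B')=4$ where $E(\mathsf C,\mathsf D)=\sum_{\epsilon,\eta}\epsilon\eta P_\phi(\epsilon,\eta|\mathsf C,\mathsf D)$.)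
   Formalization: The decomposition is stated for some choice of witness squares defining the associated maps ι_A and ι_B; for an arbitrary choice it fails (e.g. K = S×[0,1] with the squares taken at a different height). *)

theory Defs
  imports "HOL-Analysis.Analysis" "HOL-Library.Function_Algebras"
begin

(* Real-valued functions form a real vector space pointwise; this makes span, convex hull,
   subspace, linear, ... available for functionals and for bilinear forms. *)
instantiation "fun" :: (type, real_vector) real_vector
begin

definition scaleR_fun :: "real \<Rightarrow> ('a \<Rightarrow> 'b) \<Rightarrow> 'a \<Rightarrow> 'b"
  where "scaleR_fun r f = (\<lambda>x. r *\<^sub>R f x)"

instance
  by standard (simp_all add: scaleR_fun_def fun_eq_iff algebra_simps)

end

lemma scaleR_fun_apply [simp]: "(r *\<^sub>R f) x = r *\<^sub>R f x"
  for f :: "'a \<Rightarrow> 'b::real_vector"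
  by (simp add: scaleR_fun_def)


definition state_space :: "'a::euclidean_space set \<Rightarrow> bool"
  where "state_space K \<longleftrightarrow> K \<noteq> {} \<and> compact K \<and> convex K"

definition affine_map_on :: "'a::real_vector set \<Rightarrow> ('a \<Rightarrow> 'b::real_vector) \<Rightarrow> bool"
  where "affine_map_on K T \<longleftrightarrow>
    (\<forall>x\<in>K. \<forall>y\<in>K. \<forall>t\<in>{0..1}. T ((1 - t) *\<^sub>R x + t *\<^sub>R y) = (1 - t) *\<^sub>R T x + t *\<^sub>R T y)"

(* A function on K is represented by its extension by 0 outside K, so that equality of
   elements of A(K) is equality of HOL functions. *)
definition affine_funs :: "'a::real_vector set \<Rightarrow> ('a \<Rightarrow> real) set"
  where "affine_funs K = {f. affine_map_on K f \<and> (\<forall>x. x \<notin> K \<longrightarrow> f x = 0)}"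

definition unit_fun :: "'a set \<Rightarrow> 'a \<Rightarrow> real"
  where "unit_fun K = (\<lambda>x. if x \<in> K then 1 else 0)"

definition pos_affine_funs :: "'a::real_vector set \<Rightarrow> ('a \<Rightarrow> real) set"
  where "pos_affine_funs K = {f \<in> affine_funs K. \<forall>x\<in>K. 0 \<le> f x}"

definition effects :: "'a::real_vector set \<Rightarrow> ('a \<Rightarrow> real) set"
  where "effects K = {f \<in> affine_funs K. \<forall>x\<in>K. 0 \<le> f x \<and> f x \<le> 1}"

(* A functional on A(K) is likewise represented by its extension by 0 outside A(K). *)
definition dual_space :: "'a::real_vector set \<Rightarrow> (('a \<Rightarrow> real) \<Rightarrow> real) set"
  where "dual_space K = {\<psi>.
    (\<forall>f\<in>affine_funs K. \<forall>g\<in>affine_funs K. \<psi> (f + g) = \<psi> f + \<psi> g) \<and>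
    (\<forall>f\<in>affine_funs K. \<forall>c. \<psi> (c *\<^sub>R f) = c * \<psi> f) \<and>
    (\<forall>f. f \<notin> affine_funs K \<longrightarrow> \<psi> f = 0)}"

definition point_eval :: "'a::real_vector set \<Rightarrow> 'a \<Rightarrow> ('a \<Rightarrow> real) \<Rightarrow> real"
  where "point_eval K x = (\<lambda>f. if f \<in> affine_funs K then f x else 0)"


definition compatible :: "'a::real_vector set \<Rightarrow> ('a \<Rightarrow> real) \<Rightarrow> ('a \<Rightarrow> real) \<Rightarrow> bool"
  where "compatible K f f' \<longleftrightarrow>
    (\<exists>p\<in>effects K. \<forall>x\<in>K. p x \<le> f x \<and> p x \<le> f' x \<and> f x + f' x \<le> 1 + p x)"

definition degree_of_compatibility ::
    "'a::real_vector set \<Rightarrow> ('a \<Rightarrow> real) \<Rightarrow> ('a \<Rightarrow> real) \<Rightarrow> real"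
  where "degree_of_compatibility K f f' =
    Sup {t. t \<in> {0..1} \<and> (\<exists>\<mu>\<in>{0..1}. \<exists>\<mu>'\<in>{0..1}.
      compatible K (t *\<^sub>R f + ((1 - t) * \<mu>) *\<^sub>R unit_fun K)
                   (t *\<^sub>R f' + ((1 - t) * \<mu>') *\<^sub>R unit_fun K))}"

definition maximally_incompatible ::
    "'a::real_vector set \<Rightarrow> ('a \<Rightarrow> real) \<Rightarrow> ('a \<Rightarrow> real) \<Rightarrow> bool"
  where "maximally_incompatible K f f' \<longleftrightarrow> degree_of_compatibility K f f' = 1 / 2"

definition witness_square ::
    "'a::real_vector set \<Rightarrow> ('a \<Rightarrow> real) \<Rightarrow> ('a \<Rightarrow> real) \<Rightarrow> (nat \<Rightarrow> nat \<Rightarrow> 'a) \<Rightarrow> bool"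
  where "witness_square K f f' x \<longleftrightarrow>
    (1/2) *\<^sub>R (x 0 0 + x 1 1) = (1/2) *\<^sub>R (x 1 0 + x 0 1) \<and>
    (\<forall>i\<in>{0, 1}. \<forall>j\<in>{0, 1}. x i j \<in> K \<and> f (x i j) = real i \<and> f' (x i j) = real j)"


(* The square is realised as the unit
   square of the plane, so that \<pi>_0 and \<pi>_1 are the two coordinate functions. *)

definition sq :: "nat \<Rightarrow> nat \<Rightarrow> real \<times> real"
  where "sq i j = (real i, real j)"

definition Sq :: "(real \<times> real) set"
  where "Sq = convex hull {sq 0 0, sq 1 0, sq 0 1, sq 1 1}"

definition associated_inclusion ::
    "'a::real_vector set \<Rightarrow> ('a \<Rightarrow> real) \<Rightarrow> ('a \<Rightarrow> real) \<Rightarrow> (real \<times> real \<Rightarrow> 'a) \<Rightarrow> bool"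
  where "associated_inclusion K f f' \<iota> \<longleftrightarrow>
    affine_map_on Sq \<iota> \<and> \<iota> ` Sq \<subseteq> K \<and>
    (\<exists>x. witness_square K f f' x \<and> (\<forall>i\<in>{0, 1}. \<forall>j\<in>{0, 1}. \<iota> (sq i j) = x i j))"

definition associated_projection ::
    "('a \<Rightarrow> real) \<Rightarrow> ('a \<Rightarrow> real) \<Rightarrow> 'a \<Rightarrow> real \<times> real"
  where "associated_projection f f' x =
    f x *\<^sub>R (sq 1 0 - sq 0 0) + f' x *\<^sub>R (sq 0 1 - sq 0 0) + sq 0 0"

lemma affine_map_on_associated_projection:
  assumes "f \<in> affine_funs K" "f' \<in> affine_funs K"
  shows "affine_map_on K (associated_projection f f')"
  using assms
  by (auto simp: affine_map_on_def affine_funs_def associated_projection_def sq_def algebra_simps)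

lemma associated_projection_image:
  assumes "f \<in> effects K" "f' \<in> effects K"
  shows "associated_projection f f' ` K \<subseteq> Sq"
proof
  fix z assume "z \<in> associated_projection f f' ` K"
  then obtain x where x: "x \<in> K" "z = (f x, f' x)"
    by (auto simp: associated_projection_def sq_def)
  define a b where "a = f x" and "b = f' x"
  have ab: "0 \<le> a" "a \<le> 1" "0 \<le> b" "b \<le> 1"
    using assms x(1) by (auto simp: effects_def a_def b_def)
  have cv: "convex Sq" by (simp add: Sq_def convex_convex_hull)
  have s: "sq i j \<in> Sq" if "i \<in> {0, 1}" "j \<in> {0, 1}" for i j
    using that by (auto simp: Sq_def intro: hull_inc)
  have 1: "(1 - b) *\<^sub>R sq i 0 + b *\<^sub>R sq i 1 \<in> Sq" if "i \<in> {0, 1}" for i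
    using ab that s by (intro convexD[OF cv]) auto
  have "(1 - a) *\<^sub>R ((1 - b) *\<^sub>R sq 0 0 + b *\<^sub>R sq 0 1) + a *\<^sub>R ((1 - b) *\<^sub>R sq 1 0 + b *\<^sub>R sq 1 1) \<in> Sq"
    using ab by (intro convexD[OF cv 1 1]) auto
  also have "(1 - a) *\<^sub>R ((1 - b) *\<^sub>R sq 0 0 + b *\<^sub>R sq 0 1) + a *\<^sub>R ((1 - b) *\<^sub>R sq 1 0 + b *\<^sub>R sq 1 1) = (a, b)"
    by (simp add: sq_def algebra_simps)
  finally show "z \<in> Sq" using x(2) by (simp add: a_def b_def)
qed

lemma associated_projection_inclusion:
  assumes "associated_inclusion K f f' \<iota>" "f \<in> affine_funs K" "f' \<in> affine_funs K" "p \<in> Sq"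
  shows "associated_projection f f' (\<iota> p) = p"
proof -
  let ?h = "\<lambda>p. associated_projection f f' (\<iota> p)"
  have cv: "convex Sq" by (simp add: Sq_def convex_convex_hull)
  have aff: "?h ((1 - t) *\<^sub>R x + t *\<^sub>R y) = (1 - t) *\<^sub>R ?h x + t *\<^sub>R ?h y"
    if "x \<in> Sq" "y \<in> Sq" "t \<in> {0..1}" for x y t
    using that assms(1) affine_map_on_associated_projection[OF assms(2,3)]
    by (auto simp: associated_inclusion_def affine_map_on_def image_subset_iff)
  have "convex {p \<in> Sq. ?h p = p}"
    unfolding convex_alt using cv aff by (auto simp: convex_alt)
  moreover have "{sq 0 0, sq 1 0, sq 0 1, sq 1 1} \<subseteq> {p \<in> Sq. ?h p = p}"
    using assms(1)
    by (auto simp: Sq_def associated_inclusion_def witness_square_def associated_projection_def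
        sq_def intro: hull_inc)
  ultimately have "Sq \<subseteq> {p \<in> Sq. ?h p = p}"
    unfolding Sq_def by (rule hull_minimal[rotated])
  with assms(4) show ?thesis by blast
qed


(* Linear extension A(K)^* \<rightarrow> A(L)^* of an affine map T from K to L, as the transpose of
   g \<mapsto> g \<circ> T; lift_map_point_eval shows that it extends T. *)

definition pull :: "'a set \<Rightarrow> ('a \<Rightarrow> 'b) \<Rightarrow> ('b \<Rightarrow> real) \<Rightarrow> 'a \<Rightarrow> real"
  where "pull K T g = (\<lambda>x. if x \<in> K then g (T x) else 0)"

definition lift_map ::
    "'a::real_vector set \<Rightarrow> 'b::real_vector set \<Rightarrow> ('a \<Rightarrow> 'b) \<Rightarrow>
     (('a \<Rightarrow> real) \<Rightarrow> real) \<Rightarrow> ('b \<Rightarrow> real) \<Rightarrow> real"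
  where "lift_map K L T \<psi> = (\<lambda>g. if g \<in> affine_funs L then \<psi> (pull K T g) else 0)"

definition lift_kernel ::
    "'a::real_vector set \<Rightarrow> 'b::real_vector set \<Rightarrow> ('a \<Rightarrow> 'b) \<Rightarrow> (('a \<Rightarrow> real) \<Rightarrow> real) set"
  where "lift_kernel K L T = {\<psi> \<in> dual_space K. lift_map K L T \<psi> = 0}"

lemma pull_affine:
  assumes "convex K" "affine_map_on K T" "T ` K \<subseteq> L" "g \<in> affine_funs L"
  shows "pull K T g \<in> affine_funs K"
  using assms
  unfolding affine_funs_def affine_map_on_def pull_def convex_alt
  by (auto simp: image_subset_iff)

lemma linear_lift_map: "linear (lift_map K L T)"
  by (rule linearI) (auto simp: lift_map_def fun_eq_iff)

lemma lift_map_dual: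
  assumes "convex K" "affine_map_on K T" "T ` K \<subseteq> L" "\<psi> \<in> dual_space K"
  shows "lift_map K L T \<psi> \<in> dual_space L"
proof -
  have add: "g + h \<in> affine_funs L" if "g \<in> affine_funs L" "h \<in> affine_funs L" for g h
    using that by (auto simp: affine_funs_def affine_map_on_def distrib_left)
  have scale: "c *\<^sub>R g \<in> affine_funs L" if "g \<in> affine_funs L" for c g
    using that by (auto simp: affine_funs_def affine_map_on_def distrib_left mult.left_commute)
  have pull_add: "pull K T (g + h) = pull K T g + pull K T h" for g h
    by (auto simp: pull_def fun_eq_iff)
  have pull_scale: "pull K T (c *\<^sub>R g) = c *\<^sub>R pull K T g" for c g
    by (auto simp: pull_def fun_eq_iff)
  show ?thesis
    using assms(4) pull_affine[OF assms(1-3)]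
    by (auto simp: dual_space_def lift_map_def add scale pull_add pull_scale)
qed

lemma lift_map_point_eval:
  assumes "convex K" "affine_map_on K T" "T ` K \<subseteq> L" "x \<in> K"
  shows "lift_map K L T (point_eval K x) = point_eval L (T x)"
  using pull_affine[OF assms(1-3)] assms(4)
  by (auto simp: lift_map_def point_eval_def fun_eq_iff) (simp add: pull_def)


(* Elements of A(K)^* \<otimes> A(L)^* are realised as bilinear forms on
   A(K) \<times> A(L) (extended by 0), namely as the span of the forms (f, g) \<mapsto> u f * v g;
   hence (f \<otimes> g)(\<psi>) is just \<psi> f g. *)

definition tens ::
    "('f \<Rightarrow> real) \<Rightarrow> ('g \<Rightarrow> real) \<Rightarrow> 'f \<Rightarrow> 'g \<Rightarrow> real"  (infixr \<open>\<otimes>\<^sub>t\<close> 72)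
  where "u \<otimes>\<^sub>t v = (\<lambda>f g. u f * v g)"

definition tensor_space ::
    "('f \<Rightarrow> real) set \<Rightarrow> ('g \<Rightarrow> real) set \<Rightarrow> ('f \<Rightarrow> 'g \<Rightarrow> real) set"
  where "tensor_space U V = span {u \<otimes>\<^sub>t v | u v. u \<in> U \<and> v \<in> V}"

(* T \<otimes> R for the linear extensions of affine maps T from K to L and R from K' to L';
   tensor_map_tens is its defining property. *)
definition tensor_map ::
    "'a::real_vector set \<Rightarrow> 'b::real_vector set \<Rightarrow> ('a \<Rightarrow> 'b) \<Rightarrow>
     'c::real_vector set \<Rightarrow> 'd::real_vector set \<Rightarrow> ('c \<Rightarrow> 'd) \<Rightarrow>
     (('a \<Rightarrow> real) \<Rightarrow> ('c \<Rightarrow> real) \<Rightarrow> real) \<Rightarrow> ('b \<Rightarrow> real) \<Rightarrow> ('d \<Rightarrow> real) \<Rightarrow> real"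
  where "tensor_map K L T K' L' R \<psi> =
    (\<lambda>g h. if g \<in> affine_funs L \<and> h \<in> affine_funs L'
           then \<psi> (pull K T g) (pull K' R h) else 0)"

lemma linear_tensor_map: "linear (tensor_map K L T K' L' R)"
  by (rule linearI) (auto simp: tensor_map_def fun_eq_iff)

lemma tensor_map_tens:
  "tensor_map K L T K' L' R (u \<otimes>\<^sub>t v) = lift_map K L T u \<otimes>\<^sub>t lift_map K' L' R v"
  by (auto simp: tensor_map_def lift_map_def tens_def fun_eq_iff)

definition min_tensor ::
    "'a::real_vector set \<Rightarrow> 'b::real_vector set \<Rightarrow> (('a \<Rightarrow> real) \<Rightarrow> ('b \<Rightarrow> real) \<Rightarrow> real) set"
  where "min_tensor K L = convex hull {point_eval K x \<otimes>\<^sub>t point_eval L y | x y. x \<in> K \<and> y \<in> L}"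

definition max_tensor ::
    "'a::real_vector set \<Rightarrow> 'b::real_vector set \<Rightarrow> (('a \<Rightarrow> real) \<Rightarrow> ('b \<Rightarrow> real) \<Rightarrow> real) set"
  where "max_tensor K L = {\<psi> \<in> tensor_space (dual_space K) (dual_space L).
    (\<forall>f\<in>pos_affine_funs K. \<forall>g\<in>pos_affine_funs L. 0 \<le> \<psi> f g) \<and>
    \<psi> (unit_fun K) (unit_fun L) = 1}"

(* Compactness refers to the topology of pointwise convergence, which on the
   finite-dimensional space A(K)^* \<otimes> A(L)^* is the Euclidean one. *)
definition joint_state_space ::
    "'a::real_vector set \<Rightarrow> 'b::real_vector set \<Rightarrow>
     (('a \<Rightarrow> real) \<Rightarrow> ('b \<Rightarrow> real) \<Rightarrow> real) set \<Rightarrow> bool"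
  where "joint_state_space K L J \<longleftrightarrow>
    compact J \<and> convex J \<and> min_tensor K L \<subseteq> J \<and> J \<subseteq> max_tensor K L"


definition outcome :: "'a set \<Rightarrow> ('a \<Rightarrow> real) \<Rightarrow> int \<Rightarrow> 'a \<Rightarrow> real"
  where "outcome K f \<epsilon> = (if \<epsilon> = 1 then f else unit_fun K - f)"

definition joint_prob ::
    "'a set \<Rightarrow> 'b set \<Rightarrow> (('a \<Rightarrow> real) \<Rightarrow> ('b \<Rightarrow> real) \<Rightarrow> real) \<Rightarrow>
     int \<Rightarrow> int \<Rightarrow> ('a \<Rightarrow> real) \<Rightarrow> ('b \<Rightarrow> real) \<Rightarrow> real"
  where "joint_prob K L \<phi> \<epsilon> \<eta> f g = \<phi> (outcome K f \<epsilon>) (outcome L g \<eta>)"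

definition PR_box ::
    "'a set \<Rightarrow> 'b set \<Rightarrow> ('a \<Rightarrow> real) \<Rightarrow> ('a \<Rightarrow> real) \<Rightarrow> ('b \<Rightarrow> real) \<Rightarrow> ('b \<Rightarrow> real) \<Rightarrow>
     (('a \<Rightarrow> real) \<Rightarrow> ('b \<Rightarrow> real) \<Rightarrow> real) \<Rightarrow> bool"
  where "PR_box K L fA fA' fB fB' \<phi> \<longleftrightarrow> (\<forall>\<epsilon>\<in>{1, -1}. \<forall>\<eta>\<in>{1, -1}.
    joint_prob K L \<phi> \<epsilon> \<eta> fA fB = (if \<epsilon> * \<eta> = 1 then 1/2 else 0) \<and>
    joint_prob K L \<phi> \<epsilon> \<eta> fA fB' = (if \<epsilon> * \<eta> = 1 then 1/2 else 0) \<and>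
    joint_prob K L \<phi> \<epsilon> \<eta> fA' fB = (if \<epsilon> * \<eta> = 1 then 1/2 else 0) \<and>
    joint_prob K L \<phi> \<epsilon> \<eta> fA' fB' = (if \<epsilon> * \<eta> = -1 then 1/2 else 0))"

definition phi_S :: "(real \<times> real \<Rightarrow> real) \<Rightarrow> (real \<times> real \<Rightarrow> real) \<Rightarrow> real"
  where "phi_S = (let s = (\<lambda>i j. point_eval Sq (sq i j)) in
    (1/2) *\<^sub>R ((s 0 0 - s 1 0) \<otimes>\<^sub>t s 0 0 + s 1 1 \<otimes>\<^sub>t s 1 0 + s 1 0 \<otimes>\<^sub>t s 0 1))"

end

theory Submission
  imports Defs
begin

text \<open>Conditioning \<open>\<phi>\<close> on the outcomes of \<open>A\<close> and \<open>A'\<close> steers the second system into four states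
  \<open>y i j\<close>, each of probability \<open>1/2\<close>: positive normalised functionals on \<open>A(K)\<close> are evaluations at
  points. The PR-box probabilities fix the values of \<open>fB\<close> and \<open>fB'\<close> at these points, and no-signalling
  (the marginal \<open>\<phi>(1, _)\<close> does not depend on the choice between \<open>A\<close> and \<open>A'\<close>) makes the
  midpoints of the two pairs coincide, so the points form a witness square; symmetrically on the
  first side. With \<open>P = \<iota> \<circ> \<Pi>\<close> on either side, the steered states
  show that \<open>(P \<otimes> id) \<phi>\<close>, \<open>(id \<otimes> P) \<phi>\<close> and \<open>(P \<otimes> P) \<phi>\<close> all equal \<open>(\<iota> \<otimes> \<iota>) \<phi>\<^sub>S\<close>; hence
  \<open>\<phi> - (\<iota> \<otimes> \<iota>) \<phi>\<^sub>S = ((id - P) \<otimes> (id - P)) \<phi>\<close>, which lies in the tensor product of the kernels.\<close>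

section \<open>Affine functions and states\<close>

lemma affine_funs_midpoint:
  assumes "f \<in> affine_funs K" "x \<in> K" "y \<in> K"
  shows "f ((1/2) *\<^sub>R (x + y)) = (f x + f y) / 2"
proof -
  have "f ((1 - 1/2) *\<^sub>R x + (1/2) *\<^sub>R y) = (1 - 1/2) *\<^sub>R f x + (1/2) *\<^sub>R f y"
    using assms unfolding affine_funs_def affine_map_on_def mem_Collect_eq
    by (elim conjE) (drule bspec, assumption, drule bspec, assumption, drule bspec[of _ _ "1/2"], simp_all)
  then show ?thesis by (simp add: scaleR_right_distrib add_divide_distrib)
qed

lemma affine_funs_parallelogram:
  assumes "f \<in> affine_funs K" "x \<in> K" "y \<in> K" "z \<in> K" "w \<in> K"
    and "(1/2) *\<^sub>R (x + y) = (1/2) *\<^sub>R (z + w)"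
  shows "f x + f y = f z + f w"
  using affine_funs_midpoint[OF assms(1), of x y] affine_funs_midpoint[OF assms(1), of z w] assms
  by simp

lemma affine_funs_add: "f \<in> affine_funs K \<Longrightarrow> g \<in> affine_funs K \<Longrightarrow> f + g \<in> affine_funs K"
  by (auto simp: affine_funs_def affine_map_on_def distrib_left)

lemma affine_funs_scale: "f \<in> affine_funs K \<Longrightarrow> c *\<^sub>R f \<in> affine_funs K"
  by (auto simp: affine_funs_def affine_map_on_def distrib_left mult.left_commute)

lemma affine_funs_diff: "f \<in> affine_funs K \<Longrightarrow> g \<in> affine_funs K \<Longrightarrow> f - g \<in> affine_funs K"
  by (auto simp: affine_funs_def affine_map_on_def algebra_simps)

lemma unit_fun_affine: "convex K \<Longrightarrow> unit_fun K \<in> affine_funs K"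
  by (auto simp: affine_funs_def affine_map_on_def unit_fun_def convex_alt)

text \<open>Restricted linear functionals serve as test functions: they recover a point of
  \<open>K\<close> from its evaluation functional.\<close>

lemma inner_affine:
  assumes "convex K"
  shows "(\<lambda>x. if x \<in> K then a \<bullet> x else 0) \<in> affine_funs K"
  using assms by (auto simp: affine_funs_def affine_map_on_def convex_alt inner_add_right)

lemma dual_spaceD:
  assumes "\<psi> \<in> dual_space K"
  shows "f \<in> affine_funs K \<Longrightarrow> g \<in> affine_funs K \<Longrightarrow> \<psi> (f + g) = \<psi> f + \<psi> g"
    and "f \<in> affine_funs K \<Longrightarrow> \<psi> (c *\<^sub>R f) = c * \<psi> f"
    and "f \<notin> affine_funs K \<Longrightarrow> \<psi> f = 0"
  using assms by (auto simp: dual_space_def)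

lemma dual_space_diff:
  assumes "\<psi> \<in> dual_space K" "f \<in> affine_funs K" "g \<in> affine_funs K"
  shows "\<psi> (f - g) = \<psi> f - \<psi> g"
proof -
  have "\<psi> (f + (-1) *\<^sub>R g) = \<psi> f + \<psi> ((-1) *\<^sub>R g)"
    by (rule dual_spaceD(1)[OF assms(1,2) affine_funs_scale[OF assms(3)]])
  moreover have "\<psi> ((-1) *\<^sub>R g) = (-1) * \<psi> g" by (rule dual_spaceD(2)[OF assms(1,3)])
  moreover have "f + (-1) *\<^sub>R g = f - g" by (simp add: fun_eq_iff)
  ultimately show ?thesis by simp
qed

lemma subspace_dual_space: "subspace (dual_space K)"
  unfolding subspace_def by (auto simp: dual_space_def algebra_simps)

lemma point_eval_dual: "point_eval K x \<in> dual_space K"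
  by (auto simp: dual_space_def point_eval_def affine_funs_add affine_funs_scale)

text \<open>The differences \<open>a (x, 1, f x) - b (y, 1, f y)\<close> with \<open>a, b \<ge> 0\<close> form a subspace on which the
  last component is determined by the first two, because \<open>f\<close> respects convex combinations.\<close>

lemma affine_fun_extension:
  fixes K :: "'a::euclidean_space set"
  assumes "convex K" "f \<in> affine_funs K"
  obtains a c where "\<And>x. x \<in> K \<Longrightarrow> f x = a \<bullet> x + c"
proof -
  define G where "G = (\<lambda>x. ((x, 1::real), f x)) ` K"
  \<comment> \<open>Affinity with unnormalised weights, because elements of the cone
    \<open>C\<close> below carry arbitrary nonnegative factors.\<close>
  have comb: "f x = (p * f y + q * f z) / (p + q)"
    if "x \<in> K" "y \<in> K" "z \<in> K" "0 \<le> p" "0 \<le> q" "0 < p + q" "(p + q) *\<^sub>R x = p *\<^sub>R y + q *\<^sub>R z"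
    for x y z p q
  proof -
    have "x = (1 / (p + q)) *\<^sub>R ((p + q) *\<^sub>R x)" using that(6) by simp
    also have "\<dots> = (p / (p + q)) *\<^sub>R y + (q / (p + q)) *\<^sub>R z"
      unfolding that(7) by (simp add: scaleR_right_distrib)
    also have pq: "p / (p + q) = 1 - q / (p + q)" using that by (simp add: field_simps)
    finally have x: "x = (1 - q / (p + q)) *\<^sub>R y + (q / (p + q)) *\<^sub>R z" .
    have "q / (p + q) \<in> {0..1}" using that by (auto simp: field_simps)
    then have "f x = (1 - q / (p + q)) *\<^sub>R f y + (q / (p + q)) *\<^sub>R f z"
      using assms(2) that(2,3) by (subst x) (simp add: affine_funs_def affine_map_on_def)
    also have "\<dots> = (p * f y + q * f z) / (p + q)"
      unfolding pq[symmetric] by (simp add: add_divide_distrib)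
    finally show ?thesis .
  qed
  define C where "C = {p *\<^sub>R ((x, 1::real), f x) | p x. 0 \<le> p \<and> x \<in> K}"
  have C_add: "u + v \<in> C" if "u \<in> C" "v \<in> C" for u v
  proof -
    from that obtain p x q y where u: "0 \<le> p" "x \<in> K" "u = p *\<^sub>R ((x, 1), f x)"
      and v: "0 \<le> q" "y \<in> K" "v = q *\<^sub>R ((y, 1), f y)" by (auto simp: C_def)
    show ?thesis
    proof (cases "p + q = 0")
      case True
      then have "p = 0" "q = 0" using u v by auto
      then show ?thesis using u v that by simp
    next
      case False
      then have pq: "0 < p + q" using u v by simp
      define z where "z = (p / (p + q)) *\<^sub>R x + (q / (p + q)) *\<^sub>R y"
      have "z \<in> K" unfolding z_def using u v pq
        by (intro convexD[OF assms(1)]) (auto simp: add_divide_distrib[symmetric])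
      moreover have e: "(p + q) *\<^sub>R z = p *\<^sub>R x + q *\<^sub>R y"
        using pq by (simp add: z_def scaleR_right_distrib)
      ultimately have "f z = (p * f x + q * f y) / (p + q)"
        using comb u v pq by blast
      then have "u + v = (p + q) *\<^sub>R ((z, 1), f z)"
        using u v pq e by simp
      then show ?thesis using \<open>z \<in> K\<close> pq by (auto simp: C_def intro!: exI[of _ "p + q"])
    qed
  qed
  have C_scale: "r *\<^sub>R u \<in> C" if "u \<in> C" "0 \<le> r" for u r
    using that by (auto simp: C_def)
  show thesis
  proof (cases "K = {}")
    case True
    then show ?thesis using that by blast
  next
    case False
    then obtain x where "x \<in> K" by blast
    then have "0 *\<^sub>R ((x, 1), f x) \<in> C" unfolding C_def by blast
    then have C0: "0 \<in> C" by (simp only: scaleR_zero_left)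
    define P where "P = {u - v | u v. u \<in> C \<and> v \<in> C}"
    have P: "u - v \<in> P" if "u \<in> C" "v \<in> C" for u v
      using that unfolding P_def by blast
    have "subspace P"
      unfolding subspace_def
    proof (intro conjI ballI allI)
      show "0 \<in> P" using P[OF C0 C0] by (simp only: diff_self)
      fix x y assume "x \<in> P" "y \<in> P"
      then obtain u v u' v' where uv: "u \<in> C" "v \<in> C" "u' \<in> C" "v' \<in> C" "x = u - v" "y = u' - v'"
        by (auto simp: P_def)
      then have "x + y = (u + u') - (v + v')" by simp
      then show "x + y \<in> P" using C_add uv P by metis
    next
      fix c x assume "x \<in> P"
      then obtain u v where uv: "u \<in> C" "v \<in> C" "x = u - v" by (auto simp: P_def)
      show "c *\<^sub>R x \<in> P"
      proof (cases "0 \<le> c")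
        case True
        then have "c *\<^sub>R x = c *\<^sub>R u - c *\<^sub>R v" using uv by (simp add: scaleR_right_diff_distrib)
        then show ?thesis using C_scale uv True P by metis
      next
        case False
        \<comment> \<open>A negative factor swaps the two cone elements.\<close>
        then have "c *\<^sub>R x = (-c) *\<^sub>R v - (-c) *\<^sub>R u" using uv by (simp add: scaleR_right_diff_distrib)
        then show ?thesis using C_scale[of _ "-c"] uv False P by (metis neg_0_le_iff_le nle_le)
      qed
    qed
    moreover have "G \<subseteq> P"
    proof
      fix v assume "v \<in> G"
      then have "\<exists>x\<in>K. v = 1 *\<^sub>R ((x, 1), f x)" by (auto simp: G_def)
      then have "v \<in> C" unfolding C_def using zero_le_one by blast
      then show "v \<in> P" using P[OF _ C0] by (simp only: diff_zero)
    qed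
    ultimately have GP: "span G \<subseteq> P" by (rule span_minimal[rotated])
    \<comment> \<open>Lifting \<open>K\<close> to height 1 turns affine functions into linear ones.
      A basis \<open>B\<close> is chosen inside the lifted set, so \<open>h\<close> can be
      prescribed by \<open>f\<close> there; agreement with \<open>f\<close> on the rest of
      \<open>K\<close> remains to be shown.\<close>
    define E where "E = (\<lambda>x. (x, 1::real)) ` K"
    obtain B where B: "B \<subseteq> E" "independent B" "E \<subseteq> span B"
      using maximal_independent_subset[of E] by blast
    obtain h where h: "linear h" "\<And>b. b \<in> B \<Longrightarrow> h b = f (fst b)"
      using linear_independent_extend[OF B(2), of "\<lambda>b. f (fst b)"] by blast
    have lin: "linear (\<lambda>b. (b, h b))"
      using h(1) by (intro linearI) (auto simp: linear_add linear_scale)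
    have hf: "h (x, 1) = f x" if x: "x \<in> K" for x
    proof -
      have "(x, 1) \<in> span B" using x B(3) by (auto simp: E_def)
      \<comment> \<open>The graph of \<open>h\<close> over \<open>span B\<close> is spanned by graph
        points of \<open>f\<close>, so this point is a difference of two elements of
        \<open>C\<close>.\<close>
      then have "((x, 1), h (x, 1)) \<in> (\<lambda>b. (b, h b)) ` span B" by blast
      also have "\<dots> = span ((\<lambda>b. (b, h b)) ` B)"
        using linear_span_image[OF lin] by blast
      also have "\<dots> \<subseteq> span G"
        using B(1) h(2) by (intro span_mono) (force simp: E_def G_def)
      finally have "((x, 1), h (x, 1)) \<in> P" using GP by (rule subsetD[rotated])
      then obtain u v where uv: "u \<in> C" "v \<in> C" "((x, 1), h (x, 1)) = u - v"
        unfolding P_def by blast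
      obtain p y where p: "0 \<le> p" and y: "y \<in> K" and u: "u = p *\<^sub>R ((y, 1), f y)"
        using uv(1) unfolding C_def by blast
      obtain q z where q: "0 \<le> q" and z: "z \<in> K" and v: "v = q *\<^sub>R ((z, 1), f z)"
        using uv(2) unfolding C_def by blast
      from uv(3) u v
      have e: "x = p *\<^sub>R y - q *\<^sub>R z" "p = 1 + q" "h (x, 1) = p * f y - q * f z"
        by (simp_all add: algebra_simps)
      \<comment> \<open>With the negative term moved across, \<open>y\<close> is a convex
        combination of \<open>x\<close> and \<open>z\<close> up to scale; applying \<open>f\<close>
        to it gives \<open>f x = p * f y - q * f z\<close>, the value of \<open>h\<close>.\<close>
      have "(1 + q) *\<^sub>R y = 1 *\<^sub>R x + q *\<^sub>R z"
        by (simp add: e(1) e(2)[symmetric])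
      then have "f y = (1 * f x + q * f z) / (1 + q)"
        using q y z x by (intro comb) auto
      then show ?thesis using q e(2,3) by (simp add: field_simps)
    qed
    \<comment> \<open>The sum is the vector representing the linear part \<open>h (_, 0)\<close>
      through the inner product.\<close>
    have "f x = (\<Sum>b\<in>Basis. h (b, 0) *\<^sub>R b) \<bullet> x + h (0, 1)" if "x \<in> K" for x
    proof -
      have l: "linear (\<lambda>y. h (y, 0))"
        using linear_compose[OF _ h(1), of "\<lambda>y. (y, 0)"]
        by (simp add: o_def linear_iff)
      have "h (x, 0) = (\<Sum>b\<in>Basis. h (b, 0) *\<^sub>R b) \<bullet> x"
        using Linear_Algebra.linear_componentwise[OF l, of x 1]
        by (simp add: inner_sum_left inner_sum_right inner_commute[of _ x] mult.commute)
      moreover have "h (x, 1) = h (x, 0) + h (0, 1)"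
        using linear_add[OF h(1), of "(x, 0)" "(0, 1)"] by simp
      ultimately show ?thesis using hf[OF that] by simp
    qed
    then show ?thesis using that by blast
  qed
qed

text \<open>The values of \<open>\<psi>\<close> on the coordinate functions give a candidate point.
  If it lay outside \<open>K\<close>, a separating hyperplane would supply an affine function
  positive on \<open>K\<close> with a negative value under \<open>\<psi>\<close>. By
  \<open>affine_fun_extension\<close>, linear functionals and constants exhaust the affine
  functions.\<close>

lemma state_is_point_eval:
  fixes K :: "'a::euclidean_space set"
  assumes "state_space K" "\<psi> \<in> dual_space K" "\<psi> (unit_fun K) = 1"
    and "\<And>f. f \<in> pos_affine_funs K \<Longrightarrow> 0 \<le> \<psi> f"
  shows "\<exists>x\<in>K. \<forall>f\<in>affine_funs K. \<psi> f = f x"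
proof -
  have K: "K \<noteq> {}" "compact K" "convex K" using assms(1) by (auto simp: state_space_def)
  define e where "e = (\<lambda>a x. if x \<in> K then a \<bullet> x else 0)"
  have e: "e a \<in> affine_funs K" for a
    unfolding e_def by (rule inner_affine[OF K(3)])
  define y where "y = (\<Sum>b\<in>Basis. \<psi> (e b) *\<^sub>R b)"
  have l: "linear (\<lambda>a. \<psi> (e a))"
  proof (rule linearI)
    fix a b show "\<psi> (e (a + b)) = \<psi> (e a) + \<psi> (e b)"
    proof -
      have "e (a + b) = e a + e b" by (auto simp: e_def fun_eq_iff inner_add_left)
      then show ?thesis using dual_spaceD(1)[OF assms(2) e e] by simp
    qed
    fix c show "\<psi> (e (c *\<^sub>R a)) = c *\<^sub>R \<psi> (e a)"
    proof -
      have "e (c *\<^sub>R a) = c *\<^sub>R e a" by (auto simp: e_def fun_eq_iff)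
      then show ?thesis using dual_spaceD(2)[OF assms(2) e] by simp
    qed
  qed
  have ey: "\<psi> (e a) = a \<bullet> y" for a
    using Linear_Algebra.linear_componentwise[OF l, of a 1]
    by (simp add: y_def inner_sum_right mult.commute)
  have aff: "\<psi> (e a + c *\<^sub>R unit_fun K) = a \<bullet> y + c" for a c
    using dual_spaceD(1)[OF assms(2) e[of a] affine_funs_scale[OF unit_fun_affine[OF K(3)], of c]]
      dual_spaceD(2)[OF assms(2) unit_fun_affine[OF K(3)], of c] ey assms(3) by simp
  have "y \<in> K"
  proof (rule ccontr)
    assume "y \<notin> K"
    then obtain a b where ab: "a \<bullet> y < b" "\<And>x. x \<in> K \<Longrightarrow> a \<bullet> x > b"
      using separating_hyperplane_closed_point[OF K(3) compact_imp_closed[OF K(2)]] by metis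
    have "e a + (-b) *\<^sub>R unit_fun K \<in> affine_funs K"
      by (rule affine_funs_add[OF e affine_funs_scale[OF unit_fun_affine[OF K(3)]]])
    moreover have "0 \<le> (e a + (-b) *\<^sub>R unit_fun K) x" if "x \<in> K" for x
      using ab(2)[OF that] that by (simp add: e_def unit_fun_def)
    ultimately have "e a + (-b) *\<^sub>R unit_fun K \<in> pos_affine_funs K"
      by (simp add: pos_affine_funs_def)
    then have "0 \<le> \<psi> (e a + (-b) *\<^sub>R unit_fun K)" by (rule assms(4))
    then show False using aff[of a "-b"] ab(1) by simp
  qed
  moreover have "\<psi> f = f y" if f: "f \<in> affine_funs K" for f
  proof -
    obtain a c where ac: "\<And>x. x \<in> K \<Longrightarrow> f x = a \<bullet> x + c"
      using affine_fun_extension[OF K(3) f] by blast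
    have "f = e a + c *\<^sub>R unit_fun K"
      using ac f by (auto simp: e_def unit_fun_def fun_eq_iff affine_funs_def)
    then show ?thesis using aff[of a c] ac[OF \<open>y \<in> K\<close>] by simp
  qed
  ultimately show ?thesis by (intro bexI[of _ y] ballI)
qed

section \<open>Witness squares and maximal incompatibility\<close>

lemma witness_squareD:
  assumes "witness_square K f f' x"
  shows "x 0 0 \<in> K" "x 0 1 \<in> K" "x 1 0 \<in> K" "x 1 1 \<in> K"
    and "f (x 0 0) = 0" "f (x 0 1) = 0" "f (x 1 0) = 1" "f (x 1 1) = 1"
    and "f' (x 0 0) = 0" "f' (x 0 1) = 1" "f' (x 1 0) = 0" "f' (x 1 1) = 1"
    and "x 0 0 + x 1 1 = x 1 0 + x 0 1"
    and "g \<in> affine_funs K \<Longrightarrow> g (x 0 0) + g (x 1 1) = g (x 1 0) + g (x 0 1)"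
  using assms affine_funs_parallelogram[of g K "x 0 0" "x 1 1" "x 1 0" "x 0 1"]
  by (auto simp: witness_square_def)

lemma witness_square_imp_maximally_incompatible:
  assumes f: "f \<in> effects K" "f' \<in> effects K" and ws: "witness_square K f f' x"
  shows "maximally_incompatible K f f'"
proof -
  let ?D = "{t. t \<in> {0..1} \<and> (\<exists>\<mu>\<in>{0..1}. \<exists>\<mu>'\<in>{0..1}.
      compatible K (t *\<^sub>R f + ((1 - t) * \<mu>) *\<^sub>R unit_fun K)
                   (t *\<^sub>R f' + ((1 - t) * \<mu>') *\<^sub>R unit_fun K))}"
  note w = witness_squareD[OF ws]
  have "(1/2) *\<^sub>R f \<in> effects K"
    using f(1) affine_funs_scale[of f K "1/2"] by (fastforce simp: effects_def)
  \<comment> \<open>The value 1/2 is attained by replacing \<open>f\<close> with noise of constant 0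
    and \<open>f'\<close> with noise of constant 1; then \<open>p = f/2\<close> works since
    \<open>f\<close> and \<open>f'\<close> are at most 1.\<close>
  then have "compatible K ((1/2) *\<^sub>R f + ((1 - 1/2) * 0) *\<^sub>R unit_fun K)
                   ((1/2) *\<^sub>R f' + ((1 - 1/2) * 1) *\<^sub>R unit_fun K)"
    unfolding compatible_def using f
    by (intro bexI[of _ "(1/2) *\<^sub>R f"]) (auto simp: effects_def unit_fun_def add_increasing)
  then have half: "1/2 \<in> ?D"
    by (intro CollectI conjI bexI[of _ 0] bexI[of _ 1]) auto
  have "t \<le> 1/2" if "t \<in> ?D" for t
  proof -
    from that obtain \<mu> \<mu>' p where p: "p \<in> effects K"
      "\<And>z. z \<in> K \<Longrightarrow> p z \<le> t * f z + (1 - t) * \<mu> \<and> p z \<le> t * f' z + (1 - t) * \<mu>' \<and>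
        t * f z + (1 - t) * \<mu> + (t * f' z + (1 - t) * \<mu>') \<le> 1 + p z"
      unfolding compatible_def by (auto simp: unit_fun_def)
    \<comment> \<open>The bounds on \<open>p\<close> at \<open>x 1 0\<close> and
      \<open>x 0 1\<close>, with \<open>p (x 0 0)\<close> nonnegative, give
      \<open>p (x 1 1) \<le> (1 - t) * (\<mu> + \<mu>')\<close>. The last constraint at
      \<open>x 1 1\<close> then reads \<open>2 * t \<le> 1\<close>.\<close>
    have "p (x 0 0) + p (x 1 1) = p (x 1 0) + p (x 0 1)"
      using p(1) w(14) by (auto simp: effects_def)
    moreover have "0 \<le> p (x 0 0)" using p(1) w(1) by (auto simp: effects_def)
    ultimately show ?thesis
      using p(2)[OF w(4)] p(2)[OF w(3)] p(2)[OF w(2)] w by simp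
  qed
  then have "Sup ?D = 1/2"
    using half by (intro cSup_eq_maximum) auto
  then show ?thesis by (simp add: maximally_incompatible_def degree_of_compatibility_def)
qed

section \<open>The PR-box state on the square\<close>

lemma sq_in_Sq: "i \<in> {0, 1} \<Longrightarrow> j \<in> {0, 1} \<Longrightarrow> sq i j \<in> Sq"
  by (auto simp: Sq_def intro: hull_inc)

lemma convex_Sq: "convex Sq"
  by (simp add: Sq_def convex_convex_hull)

lemma affine_funs_Sq:
  assumes "g \<in> affine_funs Sq" "(a, b) \<in> Sq"
  shows "g (a, b) = g (sq 0 0) + a * (g (sq 1 0) - g (sq 0 0)) + b * (g (sq 0 1) - g (sq 0 0))"
proof -
  obtain v c where v: "\<And>x. x \<in> Sq \<Longrightarrow> g x = v \<bullet> x + c"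
    using affine_fun_extension[OF convex_Sq assms(1)] by blast
  show ?thesis
    using v[OF assms(2)] v[OF sq_in_Sq, of 0 0] v[OF sq_in_Sq, of 1 0] v[OF sq_in_Sq, of 0 1]
    by (cases v) (simp add: sq_def algebra_simps)
qed

lemma affine_funs_Sq_corner:
  assumes "g \<in> affine_funs Sq"
  shows "g (sq 1 1) = g (sq 1 0) + g (sq 0 1) - g (sq 0 0)"
  using affine_funs_Sq[OF assms, of 1 1] sq_in_Sq[of 1 1] by (simp add: sq_def)

lemma phi_S_apply:
  assumes "f \<in> affine_funs Sq" "g \<in> affine_funs Sq"
  shows "phi_S f g = ((f (sq 0 0) - f (sq 1 0)) * g (sq 0 0) + f (sq 1 1) * g (sq 1 0)
    + f (sq 1 0) * g (sq 0 1)) / 2"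
  using assms by (simp add: phi_S_def Let_def tens_def point_eval_def)

text \<open>Here \<open>a, b, c, d\<close> and \<open>p, q, r, s\<close> stand for the values of two
  positive affine functions at the corners 00, 10, 01, 11, and the form is twice
  \<open>phi_S\<close>. The corner relations allow rewriting it with nonnegative coefficients, in a
  way that depends on the order of \<open>b\<close> relative to \<open>a\<close> and
  \<open>d\<close>.\<close>

lemma square_form_nonneg:
  fixes a b c d p q r s :: real
  assumes "0 \<le> a" "0 \<le> b" "0 \<le> c" "0 \<le> d" "d = b + c - a"
    and "0 \<le> p" "0 \<le> q" "0 \<le> r" "0 \<le> s" "s = q + r - p"
  shows "0 \<le> (a - b) * p + d * q + b * r"
proof (cases "b \<le> a \<or> b \<le> d")
  case True
  have "(a - b) * p + d * q + b * r = a * p + (d - b) * q + b * s"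
    unfolding assms(10) by (simp add: algebra_simps)
  moreover have "0 \<le> (a - b) * p + d * q + b * r" if "b \<le> a" using assms that by simp
  moreover have "0 \<le> a * p + (d - b) * q + b * s" if "b \<le> d" using assms that by simp
  ultimately show ?thesis using True by auto
next
  case False
  have "(a - b) * p + d * q + b * r = (b - d) * r + c * p + d * s"
    unfolding assms(5,10) by (simp add: algebra_simps)
  also have "0 \<le> \<dots>" using assms False by simp
  finally show ?thesis .
qed

text \<open>The factor \<open>s 0 0 - s 1 0\<close> is not positive, so positivity cannot be read
  off term by term; it comes from \<open>square_form_nonneg\<close> on the corner values.\<close>

lemma phi_S_max_tensor: "phi_S \<in> max_tensor Sq Sq"
proof -
  have "phi_S \<in> tensor_space (dual_space Sq) (dual_space Sq)"
    unfolding phi_S_def Let_def tensor_space_def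
    by (intro span_scale span_add span_base)
      (blast intro: point_eval_dual subspace_diff[OF subspace_dual_space])+
  moreover have "0 \<le> phi_S f g" if "f \<in> pos_affine_funs Sq" "g \<in> pos_affine_funs Sq" for f g
  proof -
    have f: "f \<in> affine_funs Sq" "g \<in> affine_funs Sq"
      using that by (auto simp: pos_affine_funs_def)
    have n: "0 \<le> f (sq i j) \<and> 0 \<le> g (sq i j)" if "i \<in> {0, 1}" "j \<in> {0, 1}" for i j
      using \<open>f \<in> pos_affine_funs Sq\<close> \<open>g \<in> pos_affine_funs Sq\<close> sq_in_Sq[OF that]
      by (auto simp: pos_affine_funs_def)
    show ?thesis
      using square_form_nonneg[OF _ _ _ _ affine_funs_Sq_corner[OF f(1)] _ _ _ _
          affine_funs_Sq_corner[OF f(2)]] n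
      by (simp add: phi_S_apply[OF f])
  qed
  moreover have "phi_S (unit_fun Sq) (unit_fun Sq) = 1"
    using phi_S_apply[OF unit_fun_affine[OF convex_Sq] unit_fun_affine[OF convex_Sq]] sq_in_Sq
    by (simp add: unit_fun_def)
  ultimately show ?thesis by (simp add: max_tensor_def)
qed

section \<open>Witness squares steered by a PR-box\<close>

text \<open>Being a functional in each slot is preserved by linear combinations, so elementary
  tensors suffice.\<close>

lemma tensor_space_dual:
  assumes "\<phi> \<in> tensor_space (dual_space K) (dual_space L)"
  shows "\<phi> f \<in> dual_space L" "(\<lambda>f. \<phi> f g) \<in> dual_space K"
proof -
  have "\<phi> f \<in> dual_space L \<and> (\<lambda>f. \<phi> f g) \<in> dual_space K"
    using assms unfolding tensor_space_def
  proof (induction rule: span_induct)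
    case base
    show ?case
      unfolding subspace_def by (auto simp: dual_space_def algebra_simps)
  next
    case (step x)
    then show ?case by (auto simp: tens_def dual_space_def algebra_simps)
  qed
  then show "\<phi> f \<in> dual_space L" "(\<lambda>f. \<phi> f g) \<in> dual_space K" by auto
qed

lemma max_tensorD:
  assumes "\<phi> \<in> max_tensor K L"
  shows "\<phi> \<in> tensor_space (dual_space K) (dual_space L)"
    and "\<phi> f \<in> dual_space L" and "(\<lambda>f. \<phi> f g) \<in> dual_space K"
    and "f \<in> pos_affine_funs K \<Longrightarrow> h \<in> pos_affine_funs L \<Longrightarrow> 0 \<le> \<phi> f h"
proof -
  show \<phi>: "\<phi> \<in> tensor_space (dual_space K) (dual_space L)"
    using assms by (simp add: max_tensor_def)
  show "\<phi> f \<in> dual_space L" by (rule tensor_space_dual(1)[OF \<phi>])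
  show "(\<lambda>f. \<phi> f g) \<in> dual_space K" by (rule tensor_space_dual(2)[OF \<phi>])
  show "f \<in> pos_affine_funs K \<Longrightarrow> h \<in> pos_affine_funs L \<Longrightarrow> 0 \<le> \<phi> f h"
    using assms by (simp add: max_tensor_def)
qed

lemma outcome_pos:
  assumes "convex K" "f \<in> effects K"
  shows "outcome K f \<epsilon> \<in> pos_affine_funs K"
  using assms affine_funs_diff[OF unit_fun_affine[OF assms(1)], of f]
  by (auto simp: outcome_def pos_affine_funs_def effects_def unit_fun_def)

text \<open>Conditioning on an event of probability 1/2 means doubling:
  \<open>2 *\<^sub>R \<phi> f\<close> is positive and normalised, hence an evaluation at a
  point.\<close>

lemma steered_state:
  fixes L :: "'b::euclidean_space set"
  assumes "state_space L" "\<phi> \<in> max_tensor K L" "f \<in> pos_affine_funs K"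
    and "\<phi> f (unit_fun L) = 1/2"
  shows "\<exists>y\<in>L. \<forall>g\<in>affine_funs L. \<phi> f g = g y / 2"
proof -
  have "\<phi> f \<in> dual_space L" by (rule max_tensorD(2)[OF assms(2)])
  then have "2 *\<^sub>R \<phi> f \<in> dual_space L" by (rule subspace_scale[OF subspace_dual_space])
  moreover have "(2 *\<^sub>R \<phi> f) (unit_fun L) = 1" using assms(4) by simp
  moreover have "0 \<le> (2 *\<^sub>R \<phi> f) g" if "g \<in> pos_affine_funs L" for g
    using max_tensorD(4)[OF assms(2,3) that] by simp
  ultimately have "\<exists>y\<in>L. \<forall>g\<in>affine_funs L. (2 *\<^sub>R \<phi> f) g = g y"
    by (intro state_is_point_eval[OF assms(1)])
  then obtain y where y: "y \<in> L" "\<forall>g\<in>affine_funs L. (2 *\<^sub>R \<phi> f) g = g y"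
    by (rule bexE)
  show ?thesis
  proof (intro bexI[OF _ y(1)] ballI)
    fix g assume "g \<in> affine_funs L"
    from bspec[OF y(2) this] show "\<phi> f g = g y / 2" by simp
  qed
qed

lemma PR_box_steering:
  fixes L :: "'b::euclidean_space set"
  assumes K: "convex K" and L: "state_space L" and \<phi>: "\<phi> \<in> max_tensor K L"
    and f: "fA \<in> effects K" "fA' \<in> effects K" "fB \<in> effects L" "fB' \<in> effects L"
    and PR: "PR_box K L fA fA' fB fB' \<phi>"
  obtains y where "witness_square L fB fB' y"
    "\<And>g. g \<in> affine_funs L \<Longrightarrow> \<phi> fA g = g (y 1 1) / 2 \<and> \<phi> fA' g = g (y 1 0) / 2 \<and>
      \<phi> (unit_fun K) g = (g (y 0 0) + g (y 1 1)) / 2"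
proof -
  have cL: "convex L" using L by (simp add: state_space_def)
  have d: "\<phi> h \<in> dual_space L" "(\<lambda>h. \<phi> h g) \<in> dual_space K" for h g
    by (rule max_tensorD(2,3)[OF \<phi>])+
  have aL: "fB \<in> affine_funs L" "fB' \<in> affine_funs L" "unit_fun L \<in> affine_funs L"
    and aK: "fA \<in> affine_funs K" "fA' \<in> affine_funs K" "unit_fun K \<in> affine_funs K"
    using f unit_fun_affine K cL by (auto simp: effects_def)
  have pr: "\<phi> (outcome K fA 1) (outcome L fB 1) = 1/2" "\<phi> (outcome K fA 1) (outcome L fB (-1)) = 0"
    "\<phi> (outcome K fA 1) (outcome L fB' 1) = 1/2"
    "\<phi> (outcome K fA (-1)) (outcome L fB 1) = 0" "\<phi> (outcome K fA (-1)) (outcome L fB (-1)) = 1/2"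
    "\<phi> (outcome K fA (-1)) (outcome L fB' 1) = 0"
    "\<phi> (outcome K fA' 1) (outcome L fB 1) = 1/2" "\<phi> (outcome K fA' 1) (outcome L fB (-1)) = 0"
    "\<phi> (outcome K fA' 1) (outcome L fB' 1) = 0"
    "\<phi> (outcome K fA' (-1)) (outcome L fB 1) = 0" "\<phi> (outcome K fA' (-1)) (outcome L fB (-1)) = 1/2"
    "\<phi> (outcome K fA' (-1)) (outcome L fB' 1) = 1/2"
    using PR by (auto simp: PR_box_def joint_prob_def)
  \<comment> \<open>Summing the PR-box table over the outcomes of \<open>fB\<close> shows that each
    outcome on the first side has probability 1/2, as steering requires.\<close>
  have marginal: "\<phi> h (unit_fun L) = \<phi> h (outcome L fB 1) + \<phi> h (outcome L fB (-1))" for h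
    using dual_space_diff[OF d(1) aL(3) aL(1)] by (simp add: outcome_def)
  have steer: "\<exists>y\<in>L. \<forall>g\<in>affine_funs L. \<phi> (outcome K h \<epsilon>) g = g y / 2"
    if h: "h \<in> effects K" "\<phi> (outcome K h \<epsilon>) (unit_fun L) = 1/2" for h \<epsilon>
    using steered_state[of L \<phi> K "outcome K h \<epsilon>"] L \<phi> outcome_pos[OF K h(1)] h(2) by blast
  have "\<exists>y\<in>L. \<forall>g\<in>affine_funs L. \<phi> (outcome K fA 1) g = g y / 2"
    by (rule steer[OF f(1)]) (simp add: marginal pr)
  then obtain a where a: "a \<in> L" "\<forall>g\<in>affine_funs L. \<phi> (outcome K fA 1) g = g a / 2"
    by (rule bexE)
  have "\<exists>y\<in>L. \<forall>g\<in>affine_funs L. \<phi> (outcome K fA (-1)) g = g y / 2"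
    by (rule steer[OF f(1)]) (simp add: marginal pr)
  then obtain b where b: "b \<in> L" "\<forall>g\<in>affine_funs L. \<phi> (outcome K fA (-1)) g = g b / 2"
    by (rule bexE)
  have "\<exists>y\<in>L. \<forall>g\<in>affine_funs L. \<phi> (outcome K fA' 1) g = g y / 2"
    by (rule steer[OF f(2)]) (simp add: marginal pr)
  then obtain a' where a': "a' \<in> L" "\<forall>g\<in>affine_funs L. \<phi> (outcome K fA' 1) g = g a' / 2"
    by (rule bexE)
  have "\<exists>y\<in>L. \<forall>g\<in>affine_funs L. \<phi> (outcome K fA' (-1)) g = g y / 2"
    by (rule steer[OF f(2)]) (simp add: marginal pr)
  then obtain b' where b': "b' \<in> L" "\<forall>g\<in>affine_funs L. \<phi> (outcome K fA' (-1)) g = g b' / 2"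
    by (rule bexE)
  have y: "\<phi> fA g = g a / 2" "\<phi> (unit_fun K - fA) g = g b / 2"
      "\<phi> fA' g = g a' / 2" "\<phi> (unit_fun K - fA') g = g b' / 2" if "g \<in> affine_funs L" for g
    using bspec[OF a(2) that] bspec[OF b(2) that] bspec[OF a'(2) that] bspec[OF b'(2) that]
    by (simp_all add: outcome_def)
  have u: "\<phi> (unit_fun K) g = \<phi> h g + \<phi> (unit_fun K - h) g" if "h \<in> affine_funs K" for h g
    using dual_space_diff[OF d(2) aK(3) that, of g] by simp
  \<comment> \<open>No-signalling, tested on linear functionals: both sums describe twice the
    marginal \<open>\<phi> (unit_fun K)\<close>.\<close>
  have "(a + b) \<bullet> v = (a' + b') \<bullet> v" for v
  proof -
    have "(if a \<in> L then v \<bullet> a else 0) / 2 + (if b \<in> L then v \<bullet> b else 0) / 2 =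
      (if a' \<in> L then v \<bullet> a' else 0) / 2 + (if b' \<in> L then v \<bullet> b' else 0) / 2"
      using u[OF aK(1)] u[OF aK(2)] y[OF inner_affine[OF cL, of v]] by metis
    then show ?thesis using a(1) b(1) a'(1) b'(1) by (simp add: inner_commute[of v] inner_add_left)
  qed
  then have sum: "b + a = a' + b'" by (metis add.commute vector_eq_rdot)
  \<comment> \<open>The indices are the values of \<open>fB\<close> and \<open>fB'\<close> forced by
    the PR-box: outcomes 1 and -1 of \<open>fA\<close> lead to corners 11 and 00, those of
    \<open>fA'\<close> to corners 10 and 01.\<close>
  define z where "z i j = (if i = 0 then if j = 0 then b else b' else if j = 0 then a' else a)" for i j :: nat
  have "witness_square L fB fB' z"
    using pr y[OF aL(1)] y[OF aL(2)] a(1) b(1) a'(1) b'(1) sum by (auto simp: witness_square_def z_def outcome_def)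
  moreover have "\<phi> fA g = g (z 1 1) / 2 \<and> \<phi> fA' g = g (z 1 0) / 2 \<and>
      \<phi> (unit_fun K) g = (g (z 0 0) + g (z 1 1)) / 2" if "g \<in> affine_funs L" for g
    using y[OF that] u[OF aK(1), of g] by (simp add: z_def add_divide_distrib)
  ultimately show thesis using that by blast
qed

text \<open>The PR-box is symmetric under exchanging the parties; with
  \<open>max_tensor_swap\<close> this lets the second side steer the first.\<close>

lemma PR_box_swap:
  assumes "PR_box K L fA fA' fB fB' \<phi>"
  shows "PR_box L K fB fB' fA fA' (\<lambda>g f. \<phi> f g)"
  using assms unfolding PR_box_def joint_prob_def by auto

lemma max_tensor_swap:
  assumes "\<phi> \<in> max_tensor K L"
  shows "(\<lambda>g f. \<phi> f g) \<in> max_tensor L K"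
proof -
  define T where "T = (\<lambda>(\<phi> :: ('a \<Rightarrow> real) \<Rightarrow> ('b \<Rightarrow> real) \<Rightarrow> real) g f. \<phi> f g)"
  have T: "linear T" by (rule linearI) (auto simp: T_def fun_eq_iff)
  have "T \<phi> \<in> T ` tensor_space (dual_space K) (dual_space L)"
    using max_tensorD(1)[OF assms] by blast
  also have "\<dots> = span (T ` {u \<otimes>\<^sub>t v |u v. u \<in> dual_space K \<and> v \<in> dual_space L})"
    unfolding tensor_space_def using linear_span_image[OF T] by metis
  also have "\<dots> \<subseteq> tensor_space (dual_space L) (dual_space K)"
    unfolding tensor_space_def by (rule span_mono) (force simp: T_def tens_def mult.commute)
  finally have "(\<lambda>g f. \<phi> f g) \<in> tensor_space (dual_space L) (dual_space K)" by (simp add: T_def)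
  then show ?thesis using assms by (auto simp: max_tensor_def)
qed

section \<open>Splitting off the square\<close>

text \<open>The inclusion \<open>\<iota>\<close> in the coordinates of the unit square. Three
  corners determine it; the parallelogram relation takes care of the fourth.\<close>

definition square_inclusion :: "(nat \<Rightarrow> nat \<Rightarrow> 'a::real_vector) \<Rightarrow> real \<times> real \<Rightarrow> 'a"
  where "square_inclusion x p = x 0 0 + fst p *\<^sub>R (x 1 0 - x 0 0) + snd p *\<^sub>R (x 0 1 - x 0 0)"

lemma square_inclusion_sq:
  assumes "witness_square K f f' x"
  shows "square_inclusion x (sq 0 0) = x 0 0" "square_inclusion x (sq 1 0) = x 1 0"
    "square_inclusion x (sq 0 1) = x 0 1" "square_inclusion x (sq 1 1) = x 1 1"
  using witness_squareD(13)[OF assms] by (auto simp: square_inclusion_def sq_def algebra_simps)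

lemma associated_inclusion_square_inclusion:
  assumes "convex K" "witness_square K f f' x"
  shows "associated_inclusion K f f' (square_inclusion x)"
proof -
  note w = witness_squareD[OF assms(2)]
  have aff: "square_inclusion x ((1 - t) *\<^sub>R p + t *\<^sub>R q)
      = (1 - t) *\<^sub>R square_inclusion x p + t *\<^sub>R square_inclusion x q" for p q t
    by (simp add: square_inclusion_def algebra_simps)
  have "Sq \<subseteq> {p. square_inclusion x p \<in> K}"
    unfolding Sq_def
  proof (rule hull_minimal)
    show "{sq 0 0, sq 1 0, sq 0 1, sq 1 1} \<subseteq> {p. square_inclusion x p \<in> K}"
      using square_inclusion_sq[OF assms(2)] w by auto
    show "convex {p. square_inclusion x p \<in> K}"
      unfolding convex_alt using aff assms(1) by (auto simp: convex_alt)
  qed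
  then show ?thesis
    using assms(2) aff square_inclusion_sq[OF assms(2)]
    by (auto simp: associated_inclusion_def affine_map_on_def intro!: exI[of _ x])
qed

definition square_part ::
    "'a set \<Rightarrow> ('a \<Rightarrow> real) \<Rightarrow> ('a \<Rightarrow> real) \<Rightarrow> (nat \<Rightarrow> nat \<Rightarrow> 'a) \<Rightarrow> ('a \<Rightarrow> real) \<Rightarrow> 'a \<Rightarrow> real"
  where "square_part K f f' x g = g (x 0 0) *\<^sub>R unit_fun K + (g (x 1 0) - g (x 0 0)) *\<^sub>R f
    + (g (x 0 1) - g (x 0 0)) *\<^sub>R f'"

text \<open>The projection of \<open>\<psi>\<close> onto the kernel of \<open>\<Pi>\<close> along the image of \<open>\<iota>\<close>: \<open>square_part\<close> is
  \<open>g \<mapsto> g \<circ> \<iota> \<circ> \<Pi>\<close>.\<close>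

definition kernel_part ::
    "'a::real_vector set \<Rightarrow> ('a \<Rightarrow> real) \<Rightarrow> ('a \<Rightarrow> real) \<Rightarrow> (nat \<Rightarrow> nat \<Rightarrow> 'a) \<Rightarrow>
     (('a \<Rightarrow> real) \<Rightarrow> real) \<Rightarrow> ('a \<Rightarrow> real) \<Rightarrow> real"
  where "kernel_part K f f' x \<psi> = (\<lambda>g. if g \<in> affine_funs K then \<psi> (g - square_part K f f' x g) else 0)"

lemma square_part_affine:
  assumes "convex K" "f \<in> affine_funs K" "f' \<in> affine_funs K"
  shows "square_part K f f' x g \<in> affine_funs K"
  unfolding square_part_def
  using assms by (intro affine_funs_add affine_funs_scale unit_fun_affine)

text \<open>This is \<open>g \<circ> \<Pi> \<circ> \<iota> \<circ> \<Pi> = g \<circ> \<Pi>\<close>,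
  a consequence of \<open>\<Pi> \<circ> \<iota> = id\<close>, computed from the corner values of
  \<open>g\<close>.\<close>

lemma pull_projection:
  assumes K: "convex K" and f: "f \<in> effects K" "f' \<in> effects K"
    and ws: "witness_square K f f' x" and g: "g \<in> affine_funs Sq"
  shows "square_part K f f' x (pull K (associated_projection f f') g)
    = pull K (associated_projection f f') g"
proof
  fix z
  let ?p = "associated_projection f f'"
  note w = witness_squareD[OF ws]
  have p: "?p y = (f y, f' y)" for y by (simp add: associated_projection_def sq_def)
  show "square_part K f f' x (pull K ?p g) z = pull K ?p g z"
  proof (cases "z \<in> K")
    case True
    then have "(f z, f' z) \<in> Sq" using associated_projection_image[OF f] p by fastforce
    from affine_funs_Sq[OF g this] show ?thesis
      using True w by (simp add: square_part_def pull_def p unit_fun_def sq_def mult.commute)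
  next
    case False
    then show ?thesis using f
      by (simp add: square_part_def pull_def unit_fun_def effects_def affine_funs_def)
  qed
qed

text \<open>By \<open>pull_projection\<close> the map
  \<open>g \<mapsto> g - square_part K f f' x g\<close> annihilates every function pulled back along
  \<open>\<Pi>\<close>; composing it with \<open>\<psi>\<close> therefore gives a functional in the
  kernel.\<close>

lemma kernel_part_in_kernel:
  assumes K: "convex K" and f: "f \<in> effects K" "f' \<in> effects K"
    and ws: "witness_square K f f' x" and \<psi>: "\<psi> \<in> dual_space K"
  shows "kernel_part K f f' x \<psi> \<in> lift_kernel K Sq (associated_projection f f')"
proof -
  let ?P = "square_part K f f' x" and ?p = "associated_projection f f'"
  have fa: "f \<in> affine_funs K" "f' \<in> affine_funs K" using f by (auto simp: effects_def)
  have a: "g - ?P g \<in> affine_funs K" if "g \<in> affine_funs K" for g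
    using affine_funs_diff square_part_affine[OF K fa] that by blast
  have add: "(g + h) - ?P (g + h) = (g - ?P g) + (h - ?P h)" for g h
    by (auto simp: square_part_def fun_eq_iff algebra_simps)
  have scale: "c *\<^sub>R g - ?P (c *\<^sub>R g) = c *\<^sub>R (g - ?P g)" for c g
    by (auto simp: square_part_def fun_eq_iff algebra_simps)
  have "kernel_part K f f' x \<psi> \<in> dual_space K"
    using dual_spaceD[OF \<psi>] a
    by (auto simp: dual_space_def kernel_part_def add scale affine_funs_add affine_funs_scale)
  moreover have "lift_map K Sq ?p (kernel_part K f f' x \<psi>) = 0"
  proof
    fix g
    have "\<psi> 0 = 0" using dual_space_diff[OF \<psi> fa(1) fa(1)] by simp
    then show "lift_map K Sq ?p (kernel_part K f f' x \<psi>) g = 0 g"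
      using pull_projection[OF K f ws, of g] by (auto simp: lift_map_def kernel_part_def)
  qed
  ultimately show ?thesis by (simp add: lift_kernel_def)
qed

text \<open>In its applications \<open>\<psi>\<close> is a slice of \<open>\<phi>\<close> at a fixed
  function of the other party, and the numbers \<open>h00\<close> to \<open>h11\<close> are the
  values of that function at the steered points. The right-hand side is \<open>phi_S\<close>
  evaluated on the corner values.\<close>

lemma square_part_steered:
  assumes K: "convex K" and f: "f \<in> affine_funs K" "f' \<in> affine_funs K"
    and ws: "witness_square K f f' x" and g: "g \<in> affine_funs K"
    and \<psi>: "\<psi> \<in> dual_space K"
    and h: "\<psi> f = h11 / 2" "\<psi> f' = h10 / 2" "\<psi> (unit_fun K) = (h00 + h11) / 2"
    and sum: "h00 + h11 = h10 + h01"
  shows "\<psi> (square_part K f f' x g) =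
    ((g (x 0 0) - g (x 1 0)) * h00 + g (x 1 1) * h10 + g (x 1 0) * h01) / 2"
proof -
  note w = witness_squareD(14)[OF ws g]
  have "\<psi> (square_part K f f' x g) = g (x 0 0) * \<psi> (unit_fun K)
      + (g (x 1 0) - g (x 0 0)) * \<psi> f + (g (x 0 1) - g (x 0 0)) * \<psi> f'"
    unfolding square_part_def
    using dual_spaceD(1,2)[OF \<psi>] f unit_fun_affine[OF K] affine_funs_add affine_funs_scale by metis
  moreover have e: "g (x 1 1) = g (x 1 0) + g (x 0 1) - g (x 0 0)" "h11 = h10 + h01 - h00"
    using w sum by auto
  ultimately show ?thesis unfolding h e by (simp add: algebra_simps add_divide_distrib diff_divide_distrib)
qed

text \<open>Every joint state space lies in \<open>max_tensor\<close>, so working there covers all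
  theories. The remainder is \<open>\<phi>\<close> with the kernel projection applied on both
  sides.\<close>

lemma PR_box_decomposition:
  fixes K :: "'a::euclidean_space set" and L :: "'b::euclidean_space set"
  assumes K: "state_space K" and L: "state_space L" and \<phi>: "\<phi> \<in> max_tensor K L"
    and f: "fA \<in> effects K" "fA' \<in> effects K" "fB \<in> effects L" "fB' \<in> effects L"
    and PR: "PR_box K L fA fA' fB fB' \<phi>"
  obtains x y \<phi>p where "witness_square K fA fA' x" "witness_square L fB fB' y"
    "\<phi>p \<in> tensor_space (lift_kernel K Sq (associated_projection fA fA'))
                           (lift_kernel L Sq (associated_projection fB fB'))"
    "\<phi> = tensor_map Sq K (square_inclusion x) Sq L (square_inclusion y) phi_S + \<phi>p"
proof -
  have cK: "convex K" and cL: "convex L" using K L by (auto simp: state_space_def)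
  have fa: "fA \<in> affine_funs K" "fA' \<in> affine_funs K" "fB \<in> affine_funs L" "fB' \<in> affine_funs L"
    using f by (auto simp: effects_def)
  note \<phi>t = max_tensorD(1)[OF \<phi>]
  have d: "\<phi> h \<in> dual_space L" "(\<lambda>h. \<phi> h g) \<in> dual_space K" for h g
    by (rule max_tensorD(2,3)[OF \<phi>])+
  obtain y where wy: "witness_square L fB fB' y" and y: "\<And>g. g \<in> affine_funs L \<Longrightarrow>
      \<phi> fA g = g (y 1 1) / 2 \<and> \<phi> fA' g = g (y 1 0) / 2 \<and>
      \<phi> (unit_fun K) g = (g (y 0 0) + g (y 1 1)) / 2"
    using PR_box_steering[OF cK L \<phi> f PR] by blast
  obtain x where wx: "witness_square K fA fA' x" and x: "\<And>g. g \<in> affine_funs K \<Longrightarrow>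
      \<phi> g fB = g (x 1 1) / 2 \<and> \<phi> g fB' = g (x 1 0) / 2 \<and>
      \<phi> g (unit_fun L) = (g (x 0 0) + g (x 1 1)) / 2"
    using PR_box_steering[OF cL K max_tensor_swap[OF \<phi>] f(3,4,1,2) PR_box_swap[OF PR]] by blast
  define PA QA PB QB where "PA = square_part K fA fA' x" and "QA = kernel_part K fA fA' x"
    and "PB = square_part L fB fB' y" and "QB = kernel_part L fB fB' y"
  \<comment> \<open>\<open>M\<close> is the form of
    \<open>(\<iota>A \<otimes> \<iota>B) phi_S\<close>, written through the two witness
    squares.\<close>
  define M where "M g h = ((g (x 0 0) - g (x 1 0)) * h (y 0 0) + g (x 1 1) * h (y 1 0)
      + g (x 1 0) * h (y 0 1)) / 2" for g :: "'a \<Rightarrow> real" and h :: "'b \<Rightarrow> real"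
  have A: "PA g \<in> affine_funs K" for g unfolding PA_def by (rule square_part_affine[OF cK fa(1,2)])
  have B: "PB g \<in> affine_funs L" for g unfolding PB_def by (rule square_part_affine[OF cL fa(3,4)])
  have MA: "\<phi> (PA g) h = M g h" if g: "g \<in> affine_funs K" and h: "h \<in> affine_funs L" for g h
    unfolding PA_def M_def
    using y[OF h] witness_squareD(14)[OF wy h]
    by (intro square_part_steered[OF cK fa(1,2) wx g d(2)]) auto
  have MB: "\<phi> g (PB h) = M g h" if g: "g \<in> affine_funs K" and h: "h \<in> affine_funs L" for g h
  proof -
    have "\<phi> g (PB h) = ((h (y 0 0) - h (y 1 0)) * g (x 0 0) + h (y 1 1) * g (x 1 0)
      + h (y 1 0) * g (x 0 1)) / 2"
      unfolding PB_def
      using x[OF g] witness_squareD(14)[OF wx g]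
      by (intro square_part_steered[OF cL fa(3,4) wy h d(1)]) auto
    \<comment> \<open>Steering from the other side yields the transposed expression; the
      parallelogram relations make it agree with \<open>M\<close>.\<close>
    also have "\<dots> = M g h"
    proof -
      have e: "g (x 1 1) = g (x 1 0) + g (x 0 1) - g (x 0 0)" "h (y 1 1) = h (y 1 0) + h (y 0 1) - h (y 0 0)"
        using witness_squareD(14)[OF wx g] witness_squareD(14)[OF wy h] by auto
      show ?thesis unfolding M_def e by (simp add: algebra_simps)
    qed
    finally show ?thesis .
  qed
  \<comment> \<open>The projection fixes the witness square, and \<open>M\<close> depends on
    \<open>g\<close> only through its values there.\<close>
  have PAx: "PA g (x i j) = g (x i j)" if "g \<in> affine_funs K" "i \<in> {0,1}" "j \<in> {0,1}" for g i j
    using that(2,3) witness_squareD(1-12)[OF wx] witness_squareD(14)[OF wx that(1)]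
    by (auto simp: PA_def square_part_def unit_fun_def)
  have MP: "M (PA g) h = M g h" if "g \<in> affine_funs K" for g h
    by (simp add: M_def PAx[OF that])
  \<comment> \<open>\<open>Q\<close> is the tensor product of the two kernel projections; as a
    linear map sending elementary tensors to elementary tensors, it carries the span into the tensor
    product of the kernels.\<close>
  define Q where "Q = (\<lambda>\<psi> g h. if g \<in> affine_funs K \<and> h \<in> affine_funs L
      then \<psi> (g - PA g) (h - PB h) else (0::real))"
  define \<phi>p where "\<phi>p = Q \<phi>"
  have linQ: "linear Q" by (rule linearI) (auto simp: Q_def fun_eq_iff)
  have Qt: "Q (u \<otimes>\<^sub>t v) = QA u \<otimes>\<^sub>t QB v" for u v
    by (auto simp: Q_def tens_def QA_def QB_def PA_def PB_def kernel_part_def fun_eq_iff)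
  have "\<phi>p \<in> Q ` tensor_space (dual_space K) (dual_space L)"
    using \<phi>t by (simp add: \<phi>p_def)
  also have "\<dots> = span (Q ` {u \<otimes>\<^sub>t v |u v. u \<in> dual_space K \<and> v \<in> dual_space L})"
    unfolding tensor_space_def using linear_span_image[OF linQ] by metis
  also have "\<dots> \<subseteq> tensor_space (lift_kernel K Sq (associated_projection fA fA'))
                           (lift_kernel L Sq (associated_projection fB fB'))"
    unfolding tensor_space_def
  proof (rule span_mono, clarsimp)
    fix u v assume "u \<in> dual_space K" "v \<in> dual_space L"
    then have "QA u \<in> lift_kernel K Sq (associated_projection fA fA')"
        "QB v \<in> lift_kernel L Sq (associated_projection fB fB')"
      using kernel_part_in_kernel[OF cK f(1,2) wx] kernel_part_in_kernel[OF cL f(3,4) wy]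
      by (auto simp: QA_def QB_def)
    then show "\<exists>u' v'. Q (u \<otimes>\<^sub>t v) = u' \<otimes>\<^sub>t v' \<and> u' \<in> lift_kernel K Sq (associated_projection fA fA')
        \<and> v' \<in> lift_kernel L Sq (associated_projection fB fB')"
      using Qt by blast
  qed
  finally have "\<phi>p \<in> tensor_space (lift_kernel K Sq (associated_projection fA fA'))
                           (lift_kernel L Sq (associated_projection fB fB'))" .
  moreover have "\<phi> = tensor_map Sq K (square_inclusion x) Sq L (square_inclusion y) phi_S + \<phi>p"
  proof (intro ext)
    fix g h
    let ?ix = "square_inclusion x" and ?iy = "square_inclusion y"
    show "\<phi> g h = (tensor_map Sq K ?ix Sq L ?iy phi_S + \<phi>p) g h"
    proof (cases "g \<in> affine_funs K \<and> h \<in> affine_funs L")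
      case True
      then have g: "g \<in> affine_funs K" and h: "h \<in> affine_funs L" by auto
      have "pull Sq ?ix g \<in> affine_funs Sq" "pull Sq ?iy h \<in> affine_funs Sq"
        using associated_inclusion_square_inclusion[OF cK wx]
          associated_inclusion_square_inclusion[OF cL wy] g h
        unfolding associated_inclusion_def by (blast intro: pull_affine[OF convex_Sq])+
      then have "tensor_map Sq K ?ix Sq L ?iy phi_S g h = M g h"
        using g h sq_in_Sq square_inclusion_sq[OF wx] square_inclusion_sq[OF wy]
        by (simp add: tensor_map_def phi_S_apply M_def pull_def)
      moreover have "\<phi>p g h = \<phi> g h - M g h"
      proof -
        have "\<phi>p g h = \<phi> (g - PA g) (h - PB h)" using g h by (simp add: \<phi>p_def Q_def)
        also have "\<dots> = \<phi> (g - PA g) h - \<phi> (g - PA g) (PB h)"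
          by (rule dual_space_diff[OF d(1) h B])
        also have "\<dots> = (\<phi> g h - \<phi> (PA g) h) - (\<phi> g (PB h) - \<phi> (PA g) (PB h))"
          using dual_space_diff[OF d(2) g A] by simp
        \<comment> \<open>All three terms containing a projection equal \<open>M g h\<close>, and
          two of them cancel.\<close>
        also have "\<dots> = \<phi> g h - M g h"
          using MA[OF g h] MB[OF g h] MB[OF A h] MP[OF g] by simp
        finally show ?thesis .
      qed
      ultimately show ?thesis by simp
    next
      case False
      \<comment> \<open>Outside the affine functions every form involved is extended by 0.\<close>
      then have "\<phi> g h = 0" using dual_spaceD(3)[OF d(1)] dual_spaceD(3)[OF d(2)] by blast
      then show ?thesis using False by (auto simp: tensor_map_def \<phi>p_def Q_def)
    qed
  qed
  ultimately show thesis using that wx wy by blast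
qed

theorem theorem1:
  fixes K :: "'a::euclidean_space set"
    and J :: "(('a \<Rightarrow> real) \<Rightarrow> ('a \<Rightarrow> real) \<Rightarrow> real) set"
    and fA fA' fB fB' :: "'a \<Rightarrow> real"
    and \<phi> :: "('a \<Rightarrow> real) \<Rightarrow> ('a \<Rightarrow> real) \<Rightarrow> real"
  assumes "state_space K"
    and "joint_state_space K K J"
    and "fA \<in> effects K" and "fA' \<in> effects K"
    and "fB \<in> effects K" and "fB' \<in> effects K"
    and "\<phi> \<in> J"
    and "PR_box K K fA fA' fB fB' \<phi>"
  shows "maximally_incompatible K fA fA' \<and> maximally_incompatible K fB fB' \<and>
    phi_S \<in> max_tensor Sq Sq \<and>
    (\<exists>\<iota>A \<iota>B. associated_inclusion K fA fA' \<iota>A \<and> associated_inclusion K fB fB' \<iota>B \<and>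
      (\<exists>\<phi>p \<in> tensor_space (lift_kernel K Sq (associated_projection fA fA'))
                           (lift_kernel K Sq (associated_projection fB fB')).
        \<phi> = tensor_map Sq K \<iota>A Sq K \<iota>B phi_S + \<phi>p))"
proof -
  have "\<phi> \<in> max_tensor K K" using assms(2,7) by (auto simp: joint_state_space_def)
  then obtain x y \<phi>p where w: "witness_square K fA fA' x" "witness_square K fB fB' y"
    and \<phi>p: "\<phi>p \<in> tensor_space (lift_kernel K Sq (associated_projection fA fA'))
                           (lift_kernel K Sq (associated_projection fB fB'))"
      "\<phi> = tensor_map Sq K (square_inclusion x) Sq K (square_inclusion y) phi_S + \<phi>p"
    using PR_box_decomposition[OF assms(1,1) _ assms(3-6,8)] by metis
  have "convex K" using assms(1) by (simp add: state_space_def)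
  then show ?thesis
    using w \<phi>p phi_S_max_tensor associated_inclusion_square_inclusion
      witness_square_imp_maximally_incompatible assms(3-6) by blast
qed

end
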